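(* For every even integer $n=2m$ with $n\ge 4$, each of the polynomials $\mathsf{AExc}_n^{+}(t)$ and $\mathsf{AExc}_n^{-}(t)$ can be written as a sum of two gamma positive polynomials whose centers of symmetry differ by one.
   Context: Let $\mathfrak{S}_n$ be the symmetric group on $[n]$ and $\mathcal{A}_n$ the subset of even permutations. For $\pi\in\mathfrak{S}_n$, $\mathsf{exc}(\pi)=|\{i\in[n]:\pi_i>i\}|$. Define $\mathsf{AExc}_n^{+}(t)=\sum_{\pi\in\mathcal{A}_n}t^{\mathsf{exc}(\pi)}$ and $\mathsf{AExc}_n^{-}(t)=\sum_{\pi\in\mathfrak{S}_n\setminus\mathcal{A}_n}t^{\mathsf{exc}(\pi)}$. For a nonzero $f(t)=\sum_{i=0}^N a_it^i\in\mathbb{Q}[t]$ with $a_N\ne0$ and $r$ the least index with $a_r\neq 0$, $f$ is palindromic if $a_{r+i}=a_{N-i}$ for $0\le i\le (N-r)/2$, and its center of symmetry is $(N+r)/2$. A palindromic $f$ is gamma positive if $f(t)=\sum_{i=0}^{\lfloor (N-r)/2\rfloor}\gamma_i\,t^{r+i}(1+t)^{N-r-2i}$ with all $\gamma_i\ge 0$. *)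

theory Defs
  imports "HOL-Computational_Algebra.Polynomial" "HOL-Combinatorics.Permutations"
begin

definition exc :: "nat \<Rightarrow> (nat \<Rightarrow> nat) \<Rightarrow> nat" where
  "exc n \<pi> = card {i \<in> {1..n}. \<pi> i > i}"

definition AExc_plus :: "nat \<Rightarrow> rat poly" where
  "AExc_plus n = (\<Sum>\<pi> | \<pi> permutes {1..n} \<and> evenperm \<pi>. monom 1 (exc n \<pi>))"

definition AExc_minus :: "nat \<Rightarrow> rat poly" where
  "AExc_minus n = (\<Sum>\<pi> | \<pi> permutes {1..n} \<and> \<not> evenperm \<pi>. monom 1 (exc n \<pi>))"

text \<open>The notions below are meaningful for nonzero polynomials only; the zero polynomial is
  neither palindromic nor gamma positive.\<close>

definition low_degree :: "rat poly \<Rightarrow> nat" where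
  "low_degree f = (LEAST r. coeff f r \<noteq> 0)"

definition palindromic :: "rat poly \<Rightarrow> bool" where
  "palindromic f \<longleftrightarrow> f \<noteq> 0 \<and>
    (\<forall>i. 2 * i \<le> degree f - low_degree f \<longrightarrow> coeff f (low_degree f + i) = coeff f (degree f - i))"

definition center_of_symmetry :: "rat poly \<Rightarrow> rat" where
  "center_of_symmetry f = (of_nat (degree f) + of_nat (low_degree f)) / 2"

definition gamma_positive :: "rat poly \<Rightarrow> bool" where
  "gamma_positive f \<longleftrightarrow> palindromic f \<and>
    (\<exists>\<gamma> :: nat \<Rightarrow> rat. (\<forall>i \<le> (degree f - low_degree f) div 2. \<gamma> i \<ge> 0) \<and>
      f = (\<Sum>i \<le> (degree f - low_degree f) div 2.
            smult (\<gamma> i) (monom 1 (low_degree f + i) * [:1, 1:] ^ (degree f - low_degree f - 2 * i))))"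

end

theory Submission
  imports Defs
begin

text \<open>
  Building permutations of n + 1 letters by inserting n + 1 into a cycle shows that the Eulerian
  polynomial has the gamma expansion with Foata--Schuetzenberger coefficients, and that the
  sign-weighted count by excedances is (1 - t)^(n-1). For n = 2M + 2 these two polynomials are
  (1 + t) B and (1 - t) C, where B and C = ((1 + t)^2 - 4t)^M have the same center M. Hence
  the even part is (B + C)/2 + t (B - C)/2 and the odd part is (B - C)/2 + t (B + C)/2. Both
  B + C and B - C are gamma positive because the i-th gamma coefficient of B is at least
  4^i binom(M, i), the absolute value of that of C.
\<close>

section \<open>Sums and derivatives of polynomials\<close>

lemma smult_sum_right: "smult c (\<Sum>i\<in>A. f i) = (\<Sum>i\<in>A. smult c (f i))"
  by (induction A rule: infinite_finite_induct) (simp_all add: smult_add_right)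

lemma pderiv_power_eq: "pderiv (p ^ k) = of_nat k * (p ^ (k - 1) * pderiv p)"
  by (cases k) (simp_all add: pderiv_power_Suc of_nat_poly del: power_Suc)

section \<open>Excedances under insertion of a new largest letter\<close>

text \<open>The weight is a parameter so that one recurrence serves twice: \<open>s = 1\<close>
  gives the Eulerian polynomial, \<open>s = -1\<close> the sign-weighted one.\<close>

definition signed_exc_poly :: "rat \<Rightarrow> nat \<Rightarrow> rat poly" where
  "signed_exc_poly s n =
    (\<Sum>\<pi> | \<pi> permutes {1..n}. monom (if evenperm \<pi> then 1 else s) (exc n \<pi>))"

lemma exc_insert_fixed:
  assumes "p permutes {1..n}"
  shows "exc (Suc n) p = exc n p"
proof -
  have "p (Suc n) = Suc n"
    using assms by (simp add: permutes_not_in)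
  then have "{i \<in> {1..Suc n}. p i > i} = {i \<in> {1..n}. p i > i}"
    by (auto simp: le_Suc_eq)
  then show ?thesis by (simp add: exc_def)
qed

text \<open>The new permutation sends \<open>i\<close> to \<open>Suc n\<close>, sends
  \<open>Suc n\<close> to \<open>p i\<close> and agrees with \<open>p\<close> elsewhere. So
  \<open>i\<close> is now an excedance, \<open>Suc n\<close> is not, and every other position keeps
  its status.\<close>

lemma exc_insert_after:
  assumes p: "p permutes {1..n}" and i: "i \<in> {1..n}"
  shows "exc (Suc n) (transpose (Suc n) (p i) \<circ> p) = (if p i > i then exc n p else Suc (exc n p))"
proof -
  have fix_top: "p (Suc n) = Suc n"
    using p by (simp add: permutes_not_in)
  have pi: "p i \<in> {1..n}"
    using p i by (simp only: permutes_in_image)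
  have "{k \<in> {1..Suc n}. (transpose (Suc n) (p i) \<circ> p) k > k} = insert i {k \<in> {1..n}. p k > k}"
    (is "?L = ?R")
  proof (rule set_eqI)
    fix k
    consider "k = i" | "k = Suc n" | "k \<in> {1..n}" "k \<noteq> i" | "k \<notin> {1..Suc n}"
      by fastforce
    then show "k \<in> ?L \<longleftrightarrow> k \<in> ?R"
    proof cases
      case 3
      then have "p k \<noteq> p i" "p k \<in> {1..n}"
        using p permutes_in_image[OF p] by (auto dest: permutes_inj injD)
      with 3 show ?thesis by (auto simp: transpose_def)
    qed (use i pi fix_top in \<open>auto simp: transpose_def\<close>)
  qed
  then have "exc (Suc n) (transpose (Suc n) (p i) \<circ> p) = card (insert i {k \<in> {1..n}. p k > k})"
    by (simp add: exc_def)
  also have "\<dots> = (if p i > i then exc n p else Suc (exc n p))"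
    using i by (simp add: exc_def card_insert_if)
  finally show ?thesis .
qed

lemma evenperm_insert_after:
  assumes p: "p permutes {1..n}" and b: "b \<in> {1..n}"
  shows "evenperm (transpose (Suc n) b \<circ> p) \<longleftrightarrow> \<not> evenperm p"
proof -
  have "permutation p"
    using p permutation_permutes by blast
  then show ?thesis
    using b by (simp add: evenperm_comp permutation_swap_id evenperm_swap)
qed

text \<open>Substituting \<open>b = p i\<close> turns values into positions: the e excedances of
  \<open>p\<close> contribute t^e each, the other n - e positions t^(e+1). Now e t^e + (n - e)
  t^(e+1) is the operator n t + t (1 - t) d/dt applied to t^e.\<close>

lemma sum_exc_insert:
  assumes p: "p permutes {1..n}"
  shows "(\<Sum>b\<in>{1..n}. monom (c::rat) (exc (Suc n) (transpose (Suc n) b \<circ> p))) =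
    monom (of_nat n * c) 1 * monom 1 (exc n p) + [:0, c, - c:] * pderiv (monom 1 (exc n p))"
proof -
  define e where "e = exc n p"
  have e: "card {i \<in> {1..n}. p i > i} = e"
    by (simp only: e_def exc_def)
  have "e + card {i \<in> {1..n}. \<not> p i > i} = card ({i \<in> {1..n}. p i > i} \<union> {i \<in> {1..n}. \<not> p i > i})"
    unfolding e [symmetric] by (rule card_Un_disjoint [symmetric]) auto
  also have "{i \<in> {1..n}. p i > i} \<union> {i \<in> {1..n}. \<not> p i > i} = {1..n}"
    by blast
  finally have "of_nat e + rat_of_nat (card {i \<in> {1..n}. \<not> p i > i}) = of_nat n"
    unfolding of_nat_add [symmetric] by simp
  then have ne: "rat_of_nat (card {i \<in> {1..n}. \<not> p i > i}) = of_nat n - of_nat e"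
    by simp
  have "(\<Sum>b\<in>{1..n}. monom c (exc (Suc n) (transpose (Suc n) b \<circ> p))) =
      (\<Sum>i\<in>{1..n}. monom c (exc (Suc n) (transpose (Suc n) (p i) \<circ> p)))"
    using sum.permute[OF p, of "\<lambda>b. monom c (exc (Suc n) (transpose (Suc n) b \<circ> p))"]
    by (simp add: o_def)
  also have "\<dots> = (\<Sum>i\<in>{1..n}. if p i > i then monom c e else monom c (Suc e))"
    by (intro sum.cong) (simp_all add: exc_insert_after[OF p] e_def)
  also have "\<dots> = of_nat e * monom c e + of_nat (card {i \<in> {1..n}. \<not> p i > i}) * monom c (Suc e)"
    using e by (subst sum.If_cases) (auto simp: Int_def)
  also have "\<dots> = monom (of_nat e * c) e + monom ((of_nat n - of_nat e) * c) (Suc e)"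
    unfolding ne [symmetric] by (simp add: of_nat_poly smult_monom)
  also have "\<dots> = monom (of_nat n * c) 1 * monom 1 e + [:0, c, - c:] * pderiv (monom 1 e)"
  proof -
    have quad: "[:0, c, - c:] = monom c 1 + monom (- c) 2"
      by (simp add: monom_altdef numeral_2_eq_2)
    show ?thesis
      unfolding quad
      by (cases e) (simp_all add: pderiv_monom mult_monom distrib_right poly_eq_iff algebra_simps)
  qed
  finally show ?thesis by (simp add: e_def)
qed

lemma signed_exc_poly_0: "signed_exc_poly s 0 = 1"
  by (simp add: signed_exc_poly_def exc_def)

text \<open>Each permutation of n + 1 letters is uniquely
  \<open>transpose (Suc n) b \<circ> p\<close> with \<open>p\<close> fixing n + 1. The choice
  \<open>b = Suc n\<close> gives \<open>p\<close> itself; any other \<open>b\<close> flips the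
  parity, which multiplies the weight by \<open>s\<close> in both directions because
  \<open>s * s = 1\<close>.\<close>

lemma signed_exc_poly_Suc:
  assumes s: "s * s = 1"
  shows "signed_exc_poly s (Suc n) = signed_exc_poly s n
    + smult s (monom (of_nat n) 1 * signed_exc_poly s n + [:0, 1, -1:] * pderiv (signed_exc_poly s n))"
proof -
  define P where "P = {p. p permutes {1..n}}"
  define w where "w = (\<lambda>p :: nat \<Rightarrow> nat. if evenperm p then 1 else s)"
  have step: "(\<Sum>b\<in>{1..n}. monom (w (transpose (Suc n) b \<circ> p)) (exc (Suc n) (transpose (Suc n) b \<circ> p)))
      = smult s (monom (of_nat n) 1 * monom (w p) (exc n p) + [:0, 1, -1:] * pderiv (monom (w p) (exc n p)))"
    if "p \<in> P" for p
  proof -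
    have p: "p permutes {1..n}"
      using that by (simp add: P_def)
    have "(\<Sum>b\<in>{1..n}. monom (w (transpose (Suc n) b \<circ> p)) (exc (Suc n) (transpose (Suc n) b \<circ> p)))
      = (\<Sum>b\<in>{1..n}. monom (s * w p) (exc (Suc n) (transpose (Suc n) b \<circ> p)))"
      by (intro sum.cong refl) (simp add: w_def evenperm_insert_after[OF p] s)
    also have "\<dots> = monom (of_nat n * (s * w p)) 1 * monom 1 (exc n p)
        + [:0, s * w p, - (s * w p):] * pderiv (monom 1 (exc n p))"
      by (rule sum_exc_insert[OF p])
    also have "\<dots> = smult s (monom (of_nat n) 1 * monom (w p) (exc n p)
        + [:0, 1, -1:] * pderiv (monom (w p) (exc n p)))"
    proof -
      have "monom (w p) (exc n p) = smult (w p) (monom 1 (exc n p))"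
        by (simp add: smult_monom)
      moreover have "[:0, s * w p, - (s * w p):] = smult (s * w p) [:0, 1, -1:]"
        by simp
      moreover have "monom (of_nat n * (s * w p)) 1 = smult (s * w p) (monom (of_nat n) 1)"
        by (simp add: smult_monom mult_ac)
      ultimately show ?thesis
        by (simp only: pderiv_smult mult_smult_left mult_smult_right smult_add_right smult_smult)
    qed
    finally show ?thesis .
  qed
  have fin: "finite P"
    by (simp add: P_def finite_permutations)
  have ins: "{1..Suc n} = insert (Suc n) {1..n}"
    by auto
  have "signed_exc_poly s (Suc n) = (\<Sum>b\<in>{1..Suc n}. \<Sum>p\<in>P.
      monom (w (transpose (Suc n) b \<circ> p)) (exc (Suc n) (transpose (Suc n) b \<circ> p)))"
    unfolding signed_exc_poly_def P_def w_def ins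
    by (rule sum_over_permutations_insert) auto
  also have "\<dots> = (\<Sum>p\<in>P. monom (w p) (exc (Suc n) p)) + (\<Sum>p\<in>P. \<Sum>b\<in>{1..n}.
      monom (w (transpose (Suc n) b \<circ> p)) (exc (Suc n) (transpose (Suc n) b \<circ> p)))"
    unfolding ins by (subst sum.insert) (auto intro: sum.swap)
  also have "(\<Sum>p\<in>P. monom (w p) (exc (Suc n) p)) = signed_exc_poly s n"
    by (simp add: signed_exc_poly_def P_def w_def exc_insert_fixed)
  also have "(\<Sum>p\<in>P. \<Sum>b\<in>{1..n}.
      monom (w (transpose (Suc n) b \<circ> p)) (exc (Suc n) (transpose (Suc n) b \<circ> p)))
    = (\<Sum>p\<in>P. smult s (monom (of_nat n) 1 * monom (w p) (exc n p)
        + [:0, 1, -1:] * pderiv (monom (w p) (exc n p))))"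
    by (rule sum.cong[OF refl step])
  \<comment> \<open>The operator is linear, so it moves out of the sum over \<open>p\<close>;
    \<open>higher_pderiv_sum\<close> with \<open>n = 1\<close> handles the derivative.\<close>
  also have "\<dots> = smult s (monom (of_nat n) 1 * signed_exc_poly s n
        + [:0, 1, -1:] * pderiv (signed_exc_poly s n))"
    by (simp only: signed_exc_poly_def P_def w_def smult_sum_right [symmetric] sum.distrib
        sum_distrib_left [symmetric] higher_pderiv_sum [where n = 1, simplified])
  finally show ?thesis .
qed

section \<open>Parity classes and the sign-weighted enumerator\<close>

text \<open>Odd permutations cancel in the sum and even ones count twice; in the difference the
  roles are exchanged.\<close>

lemma AExc_plus_eq:
  "AExc_plus n = smult (1/2) (signed_exc_poly 1 n + signed_exc_poly (-1) n)"
proof -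
  have "signed_exc_poly 1 n + signed_exc_poly (-1) n =
      (\<Sum>\<pi> | \<pi> permutes {1..n}. if evenperm \<pi> then smult 2 (monom 1 (exc n \<pi>)) else 0)"
    unfolding signed_exc_poly_def sum.distrib [symmetric]
    by (intro sum.cong refl) (auto simp: add_monom smult_monom)
  also have "\<dots> = smult 2 (AExc_plus n)"
    by (simp add: AExc_plus_def sum.If_cases finite_permutations Int_def smult_sum_right)
  finally show ?thesis by simp
qed

lemma AExc_minus_eq:
  "AExc_minus n = smult (1/2) (signed_exc_poly 1 n - signed_exc_poly (-1) n)"
proof -
  have "signed_exc_poly 1 n - signed_exc_poly (-1) n =
      (\<Sum>\<pi> | \<pi> permutes {1..n}. if evenperm \<pi> then 0 else smult 2 (monom 1 (exc n \<pi>)))"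
    unfolding signed_exc_poly_def sum_subtractf [symmetric]
    by (intro sum.cong refl) (auto simp: diff_monom smult_monom)
  also have "\<dots> = smult 2 (AExc_minus n)"
    by (simp add: AExc_minus_def sum.If_cases finite_permutations Int_def smult_sum_right)
  finally show ?thesis by simp
qed

text \<open>The operator t (1 - t) d/dt multiplies (1 - t)^n by -n t, so one step of the recurrence
  multiplies by 1 - (n + 1) t + n t = 1 - t.\<close>

lemma signed_exc_poly_minus_one: "signed_exc_poly (-1) (Suc n) = [:1, -1:] ^ n"
proof (induction n)
  case 0
  show ?case by (simp add: signed_exc_poly_Suc signed_exc_poly_0)
next
  case (Suc n)
  define X :: "rat poly" where "X = [:0, 1:]"
  define Y :: "rat poly" where "Y = [:1, -1:]"
  have XY: "[:0, 1, -1:] = X * Y" "Y = 1 - X" "monom (of_nat (Suc n)) 1 = of_nat (Suc n) * X"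
    and dY: "pderiv Y = -1"
    by (simp_all add: X_def Y_def monom_altdef one_pCons of_nat_poly pderiv_pCons)
  have "Y * pderiv (Y ^ n) = - (of_nat n * Y ^ n)"
    unfolding pderiv_power_eq dY by (cases n) (simp_all add: mult_ac)
  then have "[:0, 1, -1:] * pderiv (Y ^ n) = - (of_nat n * X * Y ^ n)"
    by (simp add: XY(1) mult.assoc mult.left_commute)
  then have "signed_exc_poly (-1) (Suc (Suc n)) = Y ^ n - (of_nat (Suc n) * X * Y ^ n - of_nat n * X * Y ^ n)"
    by (simp add: signed_exc_poly_Suc [of _ "Suc n"] Suc.IH [folded Y_def] XY(3) [simplified])
  also have "\<dots> = Y ^ Suc n"
    by (simp add: XY(2) algebra_simps)
  finally show ?case by (simp add: Y_def)
qed

section \<open>Gamma coefficients of the Eulerian polynomials\<close>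

text \<open>With d + 1 letters, \<open>eulerian_gamma d i\<close> is to be the coefficient of t^i (1
  + t)^(d - 2i) in the Eulerian polynomial.\<close>

fun eulerian_gamma :: "nat \<Rightarrow> nat \<Rightarrow> nat" where
  "eulerian_gamma 0 i = (if i = 0 then 1 else 0)"
| "eulerian_gamma (Suc d) 0 = eulerian_gamma d 0"
| "eulerian_gamma (Suc d) (Suc i) =
    (i + 2) * eulerian_gamma d (Suc i) + 2 * (d - 2 * i) * eulerian_gamma d i"

lemma eulerian_gamma_0: "eulerian_gamma d 0 = 1"
  by (induction d) simp_all

text \<open>This makes the truncated exponent \<open>d - 2 * i\<close> harmless in sums over all
  \<open>i \<le> d\<close>.\<close>

lemma eulerian_gamma_eq_0: "d < 2 * i \<Longrightarrow> eulerian_gamma d i = 0"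
  by (induction d i rule: eulerian_gamma.induct) auto

text \<open>The first step of the recurrence has factors j + 2 and 2 (d - 2j), at least 1 and 2; the
  second multiplies by j + 2, at least 2. The form matches Pascal's rule for 4^i binom(M, i), where
  M grows by one as d grows by two.\<close>

lemma eulerian_gamma_step2:
  assumes "2 * j < d"
  shows "eulerian_gamma d (Suc j) + 4 * eulerian_gamma d j \<le> eulerian_gamma (Suc (Suc d)) (Suc j)"
proof -
  let ?g = "eulerian_gamma"
  have "2 * ?g d j \<le> 2 * (d - 2 * j) * ?g d j"
    using assms by (intro mult_right_mono) auto
  moreover have "?g d (Suc j) \<le> (j + 2) * ?g d (Suc j)"
    by simp
  ultimately have "?g d (Suc j) + 2 * ?g d j \<le> ?g (Suc d) (Suc j)"
    unfolding eulerian_gamma.simps(3) by linarith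
  moreover have "2 * ?g (Suc d) (Suc j) \<le> ?g (Suc (Suc d)) (Suc j)"
    unfolding eulerian_gamma.simps(3) [of "Suc d"] by (rule trans_le_add1, rule mult_right_mono) auto
  ultimately show ?thesis by linarith
qed

lemma eulerian_gamma_ge: "4 ^ i * (M choose i) \<le> eulerian_gamma (2 * M + 1) i"
proof (induction M arbitrary: i)
  case 0
  show ?case by (cases i) auto
next
  case (Suc M)
  show ?case
  proof (cases i)
    case 0
    then show ?thesis by (simp add: eulerian_gamma_0)
  next
    case i: (Suc j)
    show ?thesis
    proof (cases "j \<le> M")
      case False
      then have "Suc M choose i = 0"
        by (simp add: i binomial_eq_0)
      then show ?thesis by (simp only: mult_0_right le0)
    next
      case True
      have "4 ^ i * (Suc M choose i) = 4 ^ Suc j * (M choose Suc j) + 4 * (4 ^ j * (M choose j))"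
        by (simp add: i algebra_simps)
      also have "\<dots> \<le> eulerian_gamma (2 * M + 1) (Suc j) + 4 * eulerian_gamma (2 * M + 1) j"
        by (intro add_mono mult_left_mono Suc) auto
      also have "\<dots> \<le> eulerian_gamma (Suc (Suc (2 * M + 1))) (Suc j)"
        using True by (intro eulerian_gamma_step2) auto
      finally show ?thesis by (simp only: i mult_Suc_right add_Suc add_Suc_right numeral_2_eq_2 add_0)
    qed
  qed
qed

definition gamma_basis :: "nat \<Rightarrow> nat \<Rightarrow> rat poly" where
  "gamma_basis i k = monom 1 i * [:1, 1:] ^ k"

text \<open>Divided by t^i (1 + t)^k, the left side is 1 + n t + i (1 - t) + k t (1 - t)/(1 + t).
  For n = k + 1 + 2i this equals (i + 1)(1 + t) + 2k t/(1 + t). If k = 0, the term with the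
  truncated \<open>k - 1\<close> has coefficient zero.\<close>

lemma eulerian_operator_gamma_basis:
  assumes n: "n = k + 1 + 2 * i"
  shows "gamma_basis i k + (monom (of_nat n) 1 * gamma_basis i k + [:0, 1, -1:] * pderiv (gamma_basis i k)) =
    smult (of_nat (i + 1)) (gamma_basis i (k + 1)) + smult (of_nat (2 * k)) (gamma_basis (i + 1) (k - 1))"
proof -
  define X :: "rat poly" where "X = [:0, 1:]"
  define Y :: "rat poly" where "Y = [:1, 1:]"
  have q: "gamma_basis i k = X ^ i * Y ^ k" for i k
    by (simp add: gamma_basis_def X_def Y_def monom_altdef)
  have XY: "[:0, 1, -1:] = X * (1 - X)" "Y = 1 + X" "monom (of_nat n) 1 = of_nat n * X"
    and dX: "pderiv X = 1" and dY: "pderiv Y = 1"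
    by (simp_all add: X_def Y_def monom_altdef one_pCons of_nat_poly pderiv_pCons)
  have "X * pderiv (X ^ i) = of_nat i * X ^ i"
    unfolding pderiv_power_eq dX by (cases i) (simp_all add: mult_ac)
  moreover have "X * pderiv (gamma_basis i k) =
      (X * pderiv (X ^ i)) * Y ^ k + X * X ^ i * pderiv (Y ^ k)"
    by (simp add: q pderiv_mult algebra_simps)
  moreover have "pderiv (Y ^ k) = of_nat k * Y ^ (k - 1)"
    by (simp add: pderiv_power_eq dY)
  ultimately have "X * pderiv (gamma_basis i k) =
      of_nat i * X ^ i * Y ^ k + of_nat k * X * X ^ i * Y ^ (k - 1)"
    by (simp add: algebra_simps)
  then have "[:0, 1, -1:] * pderiv (gamma_basis i k) =
      (1 - X) * (of_nat i * X ^ i * Y ^ k + of_nat k * X * X ^ i * Y ^ (k - 1))"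
    by (simp only: XY(1) mult.assoc mult.left_commute [of X])
  moreover have "smult (of_nat a) p = of_nat a * p" for a and p :: "rat poly"
    by (simp add: of_nat_poly)
  moreover have "X ^ i * Y ^ k + (of_nat n * X * (X ^ i * Y ^ k)
      + (1 - X) * (of_nat i * X ^ i * Y ^ k + of_nat k * X * X ^ i * Y ^ (k - 1)))
    = of_nat (i + 1) * (X ^ i * Y ^ (k + 1)) + of_nat (2 * k) * (X ^ (i + 1) * Y ^ (k - 1))"
    unfolding n by (cases k) (simp_all add: XY(2) algebra_simps)
  ultimately show ?thesis
    by (simp only: q XY(3))
qed

lemma signed_exc_poly_one:
  "signed_exc_poly 1 (Suc d) = (\<Sum>i\<le>d. smult (of_nat (eulerian_gamma d i)) (gamma_basis i (d - 2 * i)))"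
proof (induction d)
  case 0
  show ?case by (simp add: signed_exc_poly_Suc signed_exc_poly_0 gamma_basis_def)
next
  case (Suc d)
  let ?g = "\<lambda>i. rat_of_nat (eulerian_gamma d i)"
  let ?L = "\<lambda>p. p + (monom (of_nat (Suc d)) 1 * p + [:0, 1, -1:] * pderiv p)"
  let ?a = "\<lambda>i. smult (of_nat (i + 1) * ?g i) (gamma_basis i (Suc d - 2 * i))"
  let ?b = "\<lambda>i. smult (of_nat (2 * (d - 2 * i)) * ?g i) (gamma_basis (Suc i) (Suc d - 2 * Suc i))"
  have "signed_exc_poly 1 (Suc (Suc d)) = ?L (signed_exc_poly 1 (Suc d))"
    by (simp add: signed_exc_poly_Suc [of _ "Suc d"])
  also have "\<dots> = (\<Sum>i\<le>d. smult (?g i) (?L (gamma_basis i (d - 2 * i))))"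
    unfolding Suc.IH higher_pderiv_sum [where n = 1, simplified] sum_distrib_left sum.distrib [symmetric]
    by (simp only: pderiv_smult mult_smult_right smult_add_right)
  also have "\<dots> = (\<Sum>i\<le>d. ?a i + ?b i)"
  \<comment> \<open>For 2i > d the operator lemma does not fit the truncated exponent, but there the
    coefficient vanishes.\<close>
  proof (rule sum.cong[OF refl])
    fix i
    show "smult (?g i) (?L (gamma_basis i (d - 2 * i))) = ?a i + ?b i"
    proof (cases "2 * i \<le> d")
      case True
      then have "Suc d = d - 2 * i + 1 + 2 * i" "d - 2 * i + 1 = Suc d - 2 * i"
        "d - 2 * i - 1 = Suc d - 2 * Suc i"
        by auto
      then show ?thesis
        using eulerian_operator_gamma_basis [of "Suc d" "d - 2 * i" i]
        by (simp only: smult_add_right smult_smult mult.commute Suc_eq_plus1)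
    qed (simp add: eulerian_gamma_eq_0)
  qed
  \<comment> \<open>The added term \<open>?a (Suc d)\<close> is zero; with it the index shift pairs
    \<open>?a (Suc i)\<close> with \<open>?b i\<close>, as in the recurrence.\<close>
  also have "\<dots> = (\<Sum>i\<le>Suc d. ?a i) + (\<Sum>i\<le>d. ?b i)"
    by (simp add: sum.distrib eulerian_gamma_eq_0)
  also have "\<dots> = ?a 0 + (\<Sum>i\<le>d. ?a (Suc i) + ?b i)"
    by (simp only: sum.atMost_Suc_shift sum.distrib add.assoc)
  also have "\<dots> = smult (of_nat (eulerian_gamma (Suc d) 0)) (gamma_basis 0 (Suc d - 2 * 0)) +
      (\<Sum>i\<le>d. smult (of_nat (eulerian_gamma (Suc d) (Suc i))) (gamma_basis (Suc i) (Suc d - 2 * Suc i)))"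
    by (intro arg_cong2 [where f = "(+)"] sum.cong refl)
       (simp_all only: eulerian_gamma.simps of_nat_add of_nat_mult smult_add_left, simp_all add: add_ac)
  also have "\<dots> = (\<Sum>i\<le>Suc d. smult (of_nat (eulerian_gamma (Suc d) i)) (gamma_basis i (Suc d - 2 * i)))"
    by (simp only: sum.atMost_Suc_shift)
  finally show ?case .
qed

section \<open>Gamma expansions with a prescribed center\<close>

text \<open>Lowest degree \<open>r\<close> and spread \<open>d\<close> are given in advance rather
  than read off the polynomial, so expansions about the same center can be added
  coefficientwise.\<close>

definition gamma_sum :: "nat \<Rightarrow> nat \<Rightarrow> (nat \<Rightarrow> rat) \<Rightarrow> rat poly" where
  "gamma_sum r d \<gamma> = (\<Sum>i\<le>d div 2. smult (\<gamma> i) (gamma_basis (r + i) (d - 2 * i)))"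

lemma coeff_one_plus_X_power: "coeff ([:1, 1 :: rat:] ^ k) j = of_nat (k choose j)"
proof (cases "j \<le> k")
  case False
  then have "degree ([:1, 1 :: rat:] ^ k) < j"
    by (simp add: degree_power_eq)
  with False show ?thesis by (simp add: coeff_eq_0)
qed (simp add: coeff_linear_poly_power)

lemma coeff_gamma_basis:
  "coeff (gamma_basis i k) j = (if j < i then 0 else of_nat (k choose (j - i)))"
  by (simp add: gamma_basis_def coeff_monom_mult coeff_one_plus_X_power)

text \<open>Outside the support of the basis element both coefficients vanish; inside it this is the
  symmetry of binomial coefficients.\<close>

lemma coeff_gamma_basis_symmetric:
  assumes "2 * i \<le> d" "j \<le> d"
  shows "coeff (gamma_basis (r + i) (d - 2 * i)) (r + j) = coeff (gamma_basis (r + i) (d - 2 * i)) (r + (d - j))"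
proof -
  consider "j < i" | "d < i + j" | "i \<le> j" "i + j \<le> d" by linarith
  then show ?thesis
  proof cases
    case 3
    with assms have "d - 2 * i choose (j - i) = (d - 2 * i choose (d - j - i))"
      by (subst binomial_symmetric) (auto intro!: arg_cong2 [where f = binomial])
    with 3 assms show ?thesis by (auto simp: coeff_gamma_basis)
  qed (use assms in \<open>auto simp: coeff_gamma_basis binomial_eq_0\<close>)
qed

text \<open>Only the term \<open>i = 0\<close> reaches degrees r and r + d, so both extreme
  coefficients are \<open>\<gamma> 0\<close>. Its positivity makes r and r + d the true lowest and
  highest degrees.\<close>

lemma gamma_positive_gamma_sum:
  assumes nonneg: "\<And>i. i \<le> d div 2 \<Longrightarrow> \<gamma> i \<ge> 0" and pos: "\<gamma> 0 > 0"
  shows "gamma_positive (gamma_sum r d \<gamma>)"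
    and "center_of_symmetry (gamma_sum r d \<gamma>) = of_nat r + of_nat d / 2"
proof -
  let ?f = "gamma_sum r d \<gamma>"
  have coeff: "coeff ?f k = (\<Sum>i\<le>d div 2. \<gamma> i * coeff (gamma_basis (r + i) (d - 2 * i)) k)" for k
    by (simp add: gamma_sum_def coeff_sum)
  have sym: "coeff ?f (r + j) = coeff ?f (r + (d - j))" if "j \<le> d" for j
    unfolding coeff using that by (intro sum.cong refl) (simp add: coeff_gamma_basis_symmetric)
  have "coeff ?f r = (\<Sum>i\<le>d div 2. if i = 0 then \<gamma> 0 else 0)"
    unfolding coeff by (intro sum.cong refl) (simp add: coeff_gamma_basis)
  then have bottom: "coeff ?f r = \<gamma> 0"
    by simp
  have below: "coeff ?f k = 0" if "k < r" for k
    using that by (simp add: coeff coeff_gamma_basis)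
  have above: "coeff ?f k = 0" if "r + d < k" for k
    unfolding coeff using that
    by (intro sum.neutral) (auto simp: coeff_gamma_basis intro!: binomial_eq_0)
  have top: "coeff ?f (r + d) = \<gamma> 0"
    using sym [of 0] bottom by simp
  have low: "low_degree ?f = r"
    unfolding low_degree_def using bottom below pos
    by (intro Least_equality) (auto simp: not_less [symmetric])
  have deg: "degree ?f = r + d"
    using top above pos by (intro antisym degree_le le_degree) auto
  have "?f \<noteq> 0"
    using bottom pos by auto
  then have "palindromic ?f"
    unfolding palindromic_def low deg using sym by auto
  then show "gamma_positive ?f"
    unfolding gamma_positive_def low deg
    using nonneg by (auto simp: gamma_sum_def gamma_basis_def intro!: exI [of _ \<gamma>])
  show "center_of_symmetry ?f = of_nat r + of_nat d / 2"
    by (simp add: center_of_symmetry_def low deg add_divide_distrib)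
qed

text \<open>The support loses one degree at each end, so the center stays the same.\<close>

lemma gamma_sum_drop_first:
  assumes "\<gamma> 0 = 0"
  shows "gamma_sum r (Suc (Suc d)) \<gamma> = gamma_sum (Suc r) d (\<lambda>i. \<gamma> (Suc i))"
  using assms by (simp add: gamma_sum_def sum.atMost_Suc_shift del: sum.atMost_Suc)

lemma gamma_sum_shift: "[:0, 1:] * gamma_sum r d \<gamma> = gamma_sum (Suc r) d \<gamma>"
  by (simp add: gamma_sum_def gamma_basis_def sum_distrib_left monom_Suc smult_sum_right)

lemma gamma_sum_add: "gamma_sum r d \<gamma> + gamma_sum r d \<delta> = gamma_sum r d (\<lambda>i. \<gamma> i + \<delta> i)"
  by (simp add: gamma_sum_def sum.distrib smult_add_left)

lemma gamma_sum_diff: "gamma_sum r d \<gamma> - gamma_sum r d \<delta> = gamma_sum r d (\<lambda>i. \<gamma> i - \<delta> i)"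
  by (simp add: gamma_sum_def sum_subtractf smult_diff_left)

lemma gamma_sum_smult: "smult c (gamma_sum r d \<gamma>) = gamma_sum r d (\<lambda>i. c * \<gamma> i)"
  by (simp add: gamma_sum_def smult_sum_right)

section \<open>Factorizations for an even number of letters\<close>

text \<open>The exponents 2M + 1 - 2i are odd, hence positive for i \<le> M, and each term releases
  a factor 1 + t.\<close>

lemma signed_exc_poly_one_even:
  "signed_exc_poly 1 (2 * M + 2) =
    [:1, 1:] * gamma_sum 0 (2 * M) (\<lambda>i. of_nat (eulerian_gamma (2 * M + 1) i))"
proof -
  let ?t = "\<lambda>i. smult (rat_of_nat (eulerian_gamma (2 * M + 1) i)) (gamma_basis i (2 * M + 1 - 2 * i))"
  have "signed_exc_poly 1 (2 * M + 2) = (\<Sum>i\<le>2 * M + 1. ?t i)"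
    using signed_exc_poly_one [of "2 * M + 1"] by simp
  also have "\<dots> = (\<Sum>i\<le>M. ?t i)"
    by (intro sum.mono_neutral_right) (auto simp: eulerian_gamma_eq_0)
  also have "\<dots> = (\<Sum>i\<le>M. [:1, 1:] * smult (rat_of_nat (eulerian_gamma (2 * M + 1) i)) (gamma_basis i (2 * M - 2 * i)))"
    by (intro sum.cong refl)
       (simp only: atMost_iff gamma_basis_def Suc_eq_plus1 [symmetric] Suc_diff_le mult_le_mono2
          power_Suc mult_smult_right mult.left_commute)
  finally show ?thesis by (simp only: gamma_sum_def sum_distrib_left) simp
qed

text \<open>One factor of (1 - t)^(2M+1) is split off, and the binomial theorem expands the rest
  through (1 - t)^2 = (1 + t)^2 - 4t.\<close>

lemma signed_exc_poly_minus_one_even: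
  "signed_exc_poly (-1) (2 * M + 2) =
    [:1, -1:] * gamma_sum 0 (2 * M) (\<lambda>i. (-4) ^ i * of_nat (M choose i))"
proof -
  define X :: "rat poly" where "X = [:0, 1:]"
  have neg4: "smult (-4) X ^ i = smult ((-4) ^ i) (monom 1 i)" for i
    by (simp only: smult_power X_def monom_altdef smult_1_left)
  have "[:1, -1:] ^ 2 = smult (-4) X + [:1, 1:] ^ 2"
    by (simp add: X_def power2_eq_square)
  then have "([:1, -1:] ^ 2) ^ M = (\<Sum>i\<le>M. of_nat (M choose i) * smult (-4) X ^ i * ([:1, 1:] ^ 2) ^ (M - i))"
    by (simp only: binomial_ring)
  also have "\<dots> = gamma_sum 0 (2 * M) (\<lambda>i. (-4) ^ i * of_nat (M choose i))"
    unfolding neg4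
    by (simp add: gamma_sum_def gamma_basis_def of_nat_poly mult_ac diff_mult_distrib flip: power_mult)
  finally show ?thesis
    using signed_exc_poly_minus_one [of "2 * M + 1"] by (simp add: power_mult)
qed

theorem theorem2:
  fixes n m :: nat
  assumes "n = 2 * m" and "n \<ge> 4"
  shows "(\<exists>f g. AExc_plus n = f + g \<and> gamma_positive f \<and> gamma_positive g \<and>
            \<bar>center_of_symmetry f - center_of_symmetry g\<bar> = 1) \<and>
         (\<exists>f g. AExc_minus n = f + g \<and> gamma_positive f \<and> gamma_positive g \<and>
            \<bar>center_of_symmetry f - center_of_symmetry g\<bar> = 1)"
proof -
  \<comment> \<open>Since n \<ge> 4, the subtraction is exact and M = m - 1 is positive, so 2M
    leaves room to drop a first coefficient.\<close>
  define K where "K = m - 2"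
  define M where "M = Suc K"
  have n: "n = 2 * M + 2" and d: "2 * M = Suc (Suc (2 * K))"
    using assms by (simp_all add: M_def K_def)
  define \<beta> where "\<beta> i = rat_of_nat (eulerian_gamma (2 * M + 1) i)" for i
  define \<chi> where "\<chi> i = (-4) ^ i * rat_of_nat (M choose i)" for i
  define B where "B = gamma_sum 0 (2 * M) \<beta>"
  define C where "C = gamma_sum 0 (2 * M) \<chi>"
  define \<sigma> where "\<sigma> i = 1/2 * (\<beta> i + \<chi> i)" for i
  define \<tau> where "\<tau> i = 1/2 * (\<beta> i - \<chi> i)" for i
  have abs: "\<bar>\<chi> i\<bar> \<le> \<beta> i" for i
  proof -
    have "\<bar>\<chi> i\<bar> = of_nat (4 ^ i * (M choose i))"
      by (simp add: \<chi>_def abs_mult power_abs)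
    also have "\<dots> \<le> \<beta> i"
      unfolding \<beta>_def of_nat_le_iff by (rule eulerian_gamma_ge)
    finally show ?thesis .
  qed
  have \<sigma>: "\<sigma> i \<ge> 0" and \<tau>: "\<tau> i \<ge> 0" for i
    using abs [of i] by (simp_all add: \<sigma>_def \<tau>_def abs_le_iff)
  have \<sigma>0: "\<sigma> 0 = 1" and \<tau>0: "\<tau> 0 = 0"
    by (simp_all add: \<sigma>_def \<tau>_def \<beta>_def \<chi>_def eulerian_gamma_0)
  \<comment> \<open>As \<open>\<tau> 0 = 0\<close>, the expansion of (B - C)/2 starts at
    \<open>\<tau> 1\<close>, which must be strictly positive. Here \<open>\<chi> 1\<close> is -4M
    with M \<ge> 1; for M = 0 the difference B - C would be zero.\<close>
  have "\<chi> 1 < 0"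
    by (simp add: \<chi>_def M_def)
  then have \<tau>1: "\<tau> (Suc 0) > 0"
    using abs [of 1] by (simp add: \<tau>_def)
  have S: "smult (1/2) (B + C) = gamma_sum 0 (2 * M) \<sigma>"
    by (simp add: B_def C_def gamma_sum_add gamma_sum_smult \<sigma>_def [abs_def])
  have T: "smult (1/2) (B - C) = gamma_sum 1 (2 * K) (\<lambda>i. \<tau> (Suc i))"
    using gamma_sum_drop_first [of \<tau> 0 "2 * K"] \<tau>0
    by (simp add: B_def C_def gamma_sum_diff gamma_sum_smult \<tau>_def [abs_def] d)
  have W: "signed_exc_poly 1 n = [:1, 1:] * B" "signed_exc_poly (-1) n = [:1, -1:] * C"
    using signed_exc_poly_one_even [of M] signed_exc_poly_minus_one_even [of M]
    by (simp_all add: n B_def C_def \<beta>_def [abs_def] \<chi>_def [abs_def])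
  have lin: "[:1, 1:] = 1 + [:0, 1 :: rat:]" "[:1, -1:] = 1 - [:0, 1 :: rat:]"
    by (simp_all add: one_pCons)
  have "AExc_plus n = smult (1/2) (B + C) + [:0, 1:] * smult (1/2) (B - C)"
    unfolding AExc_plus_eq W lin mult_smult_right smult_add_right [symmetric]
    by (simp add: algebra_simps del: mult_pCons_left mult_pCons_right)
  then have plus: "AExc_plus n = gamma_sum 0 (2 * M) \<sigma> + gamma_sum 2 (2 * K) (\<lambda>i. \<tau> (Suc i))"
    unfolding S T gamma_sum_shift by (simp add: numeral_2_eq_2)
  have "AExc_minus n = smult (1/2) (B - C) + [:0, 1:] * smult (1/2) (B + C)"
    unfolding AExc_minus_eq W lin mult_smult_right smult_add_right [symmetric]
    by (simp add: algebra_simps del: mult_pCons_left mult_pCons_right)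
  then have minus: "AExc_minus n = gamma_sum 1 (2 * K) (\<lambda>i. \<tau> (Suc i)) + gamma_sum 1 (2 * M) \<sigma>"
    unfolding S T gamma_sum_shift by simp
  \<comment> \<open>The centers are r + K + 1 for \<sigma> and r + K for \<tau>. In the even part r
    is 0 and 2, giving K + 1 and K + 2; in the odd part r is 1 for both, giving K + 2 and K +
    1.\<close>
  have gs: "gamma_positive (gamma_sum r (2 * M) \<sigma>)"
      "center_of_symmetry (gamma_sum r (2 * M) \<sigma>) = of_nat r + of_nat K + 1" for r
    using gamma_positive_gamma_sum [of "2 * M" \<sigma> r] \<sigma> \<sigma>0 by (simp_all add: M_def)
  have gt: "gamma_positive (gamma_sum r (2 * K) (\<lambda>i. \<tau> (Suc i)))"
      "center_of_symmetry (gamma_sum r (2 * K) (\<lambda>i. \<tau> (Suc i))) = of_nat r + of_nat K" for r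
    using gamma_positive_gamma_sum [of "2 * K" "\<lambda>i. \<tau> (Suc i)" r] \<tau> \<tau>1 by simp_all
  show ?thesis
  proof
    show "\<exists>f g. AExc_plus n = f + g \<and> gamma_positive f \<and> gamma_positive g \<and>
        \<bar>center_of_symmetry f - center_of_symmetry g\<bar> = 1"
      by (intro exI conjI, rule plus) (simp_all add: gs gt)
    show "\<exists>f g. AExc_minus n = f + g \<and> gamma_positive f \<and> gamma_positive g \<and>
        \<bar>center_of_symmetry f - center_of_symmetry g\<bar> = 1"
      by (intro exI conjI, rule minus) (simp_all add: gs gt)
  qed
qed

end
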